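(* Let $r>1$ be an integer and let $\alpha_1>0$ be a constant. Let $H$ be a $\{1,r\}$-graph. Suppose both the order of a maximum complete $\{1,r\}$-subgraph of $H$ and the order of a maximum complete $\{1\}$-subgraph of $H$ equal $t$, where $$t\ge \left\lceil \frac{[\alpha_1-(r-2)!]^{r-2}}{(r-2)!\,\alpha_1^{r-3}}\right\rceil .$$ Then $$L_{\{\alpha_1\}}(H)=L_{\{\alpha_1\}}(K_t^{\{1,r\}})=1+\alpha_1\frac{\prod_{i=1}^{r-1}(t-i)}{r!\,t^{r-1}}.$$ Furthermore, the characteristic vector of a maximum clique of $H$ is a maximizer of $L_{\{\alpha_1\}}(H,\vec x)$ over $S$.
   Context: A hypergraph $H=(V,E)$ with $V=[n]$ has edges that are subsets of $V$; $T(H)=\{|e|:e\in E\}$, and $H$ is a $T(H)$-graph. A $\{1,r\}$-graph has edges of sizes $1$ and $r$. For a set $T$ of positive integers, $K_t^T$ is the hypergraph on $[t]$ whose edges are all subsets of $[t]$ with size in $T$. A complete $\{1,r\}$-subgraph of order $t$ is a set $W$ of $t$ vertices such that every $1$-subset and every $r$-subset of $W$ is an edge of $H$; a complete $\{1\}$-subgraph of order $t$ is a set of $t$ vertices each of whose singletons is an edge of $H$. A clique of $H$ is a complete subhypergraph with edge type set $T(H)$ (here a complete $\{1,r\}$-subgraph). Let $S=\{\vec x\in\mathbb{R}^n:\sum_i x_i=1,\ x_i\ge 0\}$. For $\vec x\in S$, $$L_{\{\alpha_1\}}(H,\vec x)=\sum_{\{i\}\in E}x_i+\alpha_1\sum_{\{i_1,\dots,i_r\}\in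 E}x_{i_1}\cdots x_{i_r},\qquad L_{\{\alpha_1\}}(H)=\max_{\vec x\in S}L_{\{\alpha_1\}}(H,\vec x).$$ The characteristic vector of $U\subseteq[n]$ is the vector with entries $1/|U|$ on $U$ and $0$ elsewhere. *)

theory Defs
  imports Complex_Main
begin

text \<open>
  A hypergraph \<open>H = (V, E)\<close> with \<open>V = [n]\<close> is given by the number \<open>n\<close> and the edge set \<open>E\<close>;
  vertices are the naturals \<open>1, ..., n\<close>.
\<close>

definition hypergraph :: "nat \<Rightarrow> nat set set \<Rightarrow> bool" where
  "hypergraph n E \<longleftrightarrow> (\<forall>e\<in>E. e \<subseteq> {1..n})"

definition edge_types :: "nat set set \<Rightarrow> nat set" where
  "edge_types E = card ` E"

definition graph_of_type :: "nat set \<Rightarrow> nat \<Rightarrow> nat set set \<Rightarrow> bool" where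
  "graph_of_type T n E \<longleftrightarrow> hypergraph n E \<and> edge_types E = T"

definition complete_edges :: "nat \<Rightarrow> nat set \<Rightarrow> nat set set" where
  "complete_edges t T = {e. e \<subseteq> {1..t} \<and> card e \<in> T}"

text \<open>
  The subsets of \<open>W\<close> with size in \<open>T\<close> must all be edges; if \<open>W\<close> is smaller than some element of
  \<open>T\<close>, the condition for that size is vacuous, as it is for \<open>complete_edges\<close>.
\<close>

definition complete_subgraph :: "nat set \<Rightarrow> nat \<Rightarrow> nat set set \<Rightarrow> nat set \<Rightarrow> bool" where
  "complete_subgraph T n E W \<longleftrightarrow> W \<subseteq> {1..n} \<and> (\<forall>e. e \<subseteq> W \<and> card e \<in> T \<longrightarrow> e \<in> E)"

definition max_complete_order :: "nat set \<Rightarrow> nat \<Rightarrow> nat set set \<Rightarrow> nat" where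
  "max_complete_order T n E = Max {card W | W. complete_subgraph T n E W}"

definition clique :: "nat \<Rightarrow> nat set set \<Rightarrow> nat set \<Rightarrow> bool" where
  "clique n E W \<longleftrightarrow> complete_subgraph (edge_types E) n E W"

definition maximum_clique :: "nat \<Rightarrow> nat set set \<Rightarrow> nat set \<Rightarrow> bool" where
  "maximum_clique n E W \<longleftrightarrow> is_arg_max card (clique n E) W"

text \<open>
  A vector in \<open>\<real>\<^sup>n\<close> is a function on the naturals that vanishes outside \<open>{1..n}\<close>, so that
  hypergraphs of different orders can occur in one statement.
\<close>

definition simplex :: "nat \<Rightarrow> (nat \<Rightarrow> real) set" where
  "simplex n = {x. (\<forall>i\<in>{1..n}. 0 \<le> x i) \<and> (\<forall>i. i \<notin> {1..n} \<longrightarrow> x i = 0) \<and> (\<Sum>i=1..n. x i) = 1}"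

text \<open>
  The uniformity \<open>r\<close> is a parameter rather than being read off from \<open>E\<close>, because for \<open>t < r\<close> the
  hypergraph with edge set \<open>complete_edges t {1, r}\<close> has no edge of size \<open>r\<close>.
\<close>

definition lagrange_poly ::
    "real \<Rightarrow> nat \<Rightarrow> nat \<Rightarrow> nat set set \<Rightarrow> (nat \<Rightarrow> real) \<Rightarrow> real" where
  "lagrange_poly \<alpha> r n E x =
     (\<Sum>i | i \<in> {1..n} \<and> {i} \<in> E. x i) + \<alpha> * (\<Sum>e | e \<in> E \<and> card e = r. \<Prod>i\<in>e. x i)"

text \<open>The maximum over the simplex; it is attained for \<open>n \<ge> 1\<close> by compactness.\<close>

definition lagrangian :: "real \<Rightarrow> nat \<Rightarrow> nat \<Rightarrow> nat set set \<Rightarrow> real" where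
  "lagrangian \<alpha> r n E = (GREATEST y. y \<in> lagrange_poly \<alpha> r n E ` simplex n)"

definition char_vec :: "nat set \<Rightarrow> nat \<Rightarrow> real" where
  "char_vec U = (\<lambda>i. if i \<in> U then 1 / real (card U) else 0)"

end

theory Submission
  imports Defs
begin

text \<open>
  Let \<open>U\<close> be the set of the \<open>t\<close> vertices whose singletons are edges, and let \<open>s\<close> be the weight
  of \<open>U\<close> under \<open>x\<close>. Maclaurin's inequality on \<open>U\<close> and the bound \<open>e\<^sub>k \<le> (1 - s)\<^sup>k / k!\<close> off \<open>U\<close> bound
  the polynomial by \<open>F(s) = s + \<alpha> \<Sum>\<^sub>k (t choose k) (s/t)\<^sup>k (1 - s)\<^sup>r\<^sup>-\<^sup>k / (r - k)!\<close>. With \<open>u = s/t\<close>,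
  \<open>F'(s) \<ge> 1 - \<alpha> u (1 - u)\<^sup>r\<^sup>-\<^sup>2 / (r - 2)!\<close>, and this is nonnegative: clearly so if
  \<open>\<alpha> u \<le> (r - 2)!\<close>, and otherwise by \<open>u \<le> 1/t\<close>, \<open>1 - u \<le> 1 - (r - 2)!/\<alpha>\<close> and the hypothesis
  on \<open>t\<close>. Hence \<open>F(s) \<le> F(1)\<close>, which is the value at the characteristic vector of \<open>U\<close>.
\<close>

section \<open>Elementary symmetric sums\<close>

definition esym :: "nat \<Rightarrow> ('a \<Rightarrow> real) \<Rightarrow> 'a set \<Rightarrow> real" where
  "esym k x A = (\<Sum>S | S \<subseteq> A \<and> card S = k. \<Prod>i\<in>S. x i)"

lemma esym_0: "finite A \<Longrightarrow> esym 0 x A = 1"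
proof -
  assume "finite A"
  then have "{S. S \<subseteq> A \<and> card S = 0} = {{}}"
    by (auto simp: card_eq_0_iff dest: finite_subset)
  then show ?thesis by (simp add: esym_def)
qed

lemma esym_Suc_empty: "esym (Suc k) x {} = 0"
proof -
  have "{S. S \<subseteq> {} \<and> card S = Suc k} = {}" by auto
  then show ?thesis unfolding esym_def by (metis sum.empty)
qed

lemma esym_nonneg: "(\<And>i. i \<in> A \<Longrightarrow> 0 \<le> x i) \<Longrightarrow> 0 \<le> esym k x A"
  unfolding esym_def by (intro sum_nonneg prod_nonneg) auto

lemma sum_subsets_containing:
  assumes "finite A" "a \<in> A"
  shows "(\<Sum>S | S \<subseteq> A \<and> card S = Suc k \<and> a \<in> S. \<Prod>i\<in>S. x i) = x a * esym k x (A - {a})"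
proof -
  have "(\<Sum>S | S \<subseteq> A \<and> card S = Suc k \<and> a \<in> S. \<Prod>i\<in>S. x i)
      = (\<Sum>S | S \<subseteq> A - {a} \<and> card S = k. x a * (\<Prod>i\<in>S. x i))"
  proof (rule sum.reindex_bij_witness[where i = "insert a" and j = "\<lambda>S. S - {a}"])
    fix S assume "S \<in> {S. S \<subseteq> A \<and> card S = Suc k \<and> a \<in> S}"
    then have S: "S \<subseteq> A" "card S = Suc k" "a \<in> S" by auto
    then have f: "finite S" using assms(1) finite_subset by blast
    show "S - {a} \<in> {S. S \<subseteq> A - {a} \<and> card S = k}" using S f by auto
    show "x a * (\<Prod>i\<in>S - {a}. x i) = (\<Prod>i\<in>S. x i)"
      using prod.remove[OF f S(3), of x] by simp
    show "insert a (S - {a}) = S" using S by auto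
  next
    fix S assume "S \<in> {S. S \<subseteq> A - {a} \<and> card S = k}"
    then have S: "S \<subseteq> A - {a}" "card S = k" by auto
    then have f: "finite S" using assms(1) finite_subset by blast
    show "insert a S \<in> {S. S \<subseteq> A \<and> card S = Suc k \<and> a \<in> S}"
      using S f assms(2) by (auto simp: card_insert_if)
    show "insert a S - {a} = S" using S by auto
  qed
  then show ?thesis by (simp add: esym_def sum_distrib_left)
qed

lemma esym_Suc_remove:
  assumes "finite A" "a \<in> A"
  shows "esym (Suc k) x A = esym (Suc k) x (A - {a}) + x a * esym k x (A - {a})"
proof -
  have "{S. S \<subseteq> A \<and> card S = Suc k} =
      {S. S \<subseteq> A - {a} \<and> card S = Suc k} \<union> {S. S \<subseteq> A \<and> card S = Suc k \<and> a \<in> S}" by auto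
  moreover have "finite {S. S \<subseteq> A - {a} \<and> card S = Suc k}"
    "finite {S. S \<subseteq> A \<and> card S = Suc k \<and> a \<in> S}"
    using assms by auto
  ultimately have "esym (Suc k) x A = esym (Suc k) x (A - {a})
      + (\<Sum>S | S \<subseteq> A \<and> card S = Suc k \<and> a \<in> S. \<Prod>i\<in>S. x i)"
    unfolding esym_def by (simp only:) (rule sum.union_disjoint, auto)
  then show ?thesis using sum_subsets_containing[OF assms] by simp
qed

lemma esym_Suc_insert:
  assumes "finite A" "a \<notin> A"
  shows "esym (Suc k) x (insert a A) = esym (Suc k) x A + x a * esym k x A"
  using esym_Suc_remove[of "insert a A" a k x] assms by simp

text \<open>Double counting: each \<open>Suc k\<close>-subset of \<open>A\<close> arises once for
  every one of its elements.\<close>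

lemma sum_mult_esym_remove:
  assumes "finite A"
  shows "(\<Sum>a\<in>A. x a * esym k x (A - {a})) = real (Suc k) * esym (Suc k) x A"
proof -
  let ?T = "{S. S \<subseteq> A \<and> card S = Suc k}"
  have "(\<Sum>a\<in>A. x a * esym k x (A - {a}))
      = (\<Sum>a\<in>A. \<Sum>S | S \<in> ?T \<and> a \<in> S. \<Prod>i\<in>S. x i)"
    using sum_subsets_containing[OF assms, where k = k and x = x]
    by (intro sum.cong) (auto simp: conj_assoc)
  also have "\<dots> = (\<Sum>S\<in>?T. \<Sum>a | a \<in> A \<and> a \<in> S. \<Prod>i\<in>S. x i)"
    using assms by (intro sum.swap_restrict) auto
  also have "\<dots> = (\<Sum>S\<in>?T. real (Suc k) * (\<Prod>i\<in>S. x i))"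
  proof (intro sum.cong refl)
    fix S assume "S \<in> ?T"
    then have "{a. a \<in> A \<and> a \<in> S} = S" "card S = Suc k" by auto
    then show "(\<Sum>a | a \<in> A \<and> a \<in> S. \<Prod>i\<in>S. x i) = real (Suc k) * (\<Prod>i\<in>S. x i)" by simp
  qed
  finally show ?thesis by (simp add: esym_def sum_distrib_left)
qed

text \<open>A \<open>k\<close>-subset survives the removal of each of the \<open>card A - k\<close>
  elements outside it. The factor is a difference of reals; for \<open>k > card A\<close> it is
  negative, but then \<open>esym k x A\<close> is 0.\<close>

lemma sum_esym_remove:
  assumes "finite A"
  shows "(\<Sum>a\<in>A. esym k x (A - {a})) = (real (card A) - real k) * esym k x A"
proof (cases k)
  case 0
  then show ?thesis using assms by (simp add: esym_0)
next
  case (Suc j)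
  have "real (card A) * esym k x A
      = (\<Sum>a\<in>A. esym k x (A - {a}) + x a * esym j x (A - {a}))"
    using esym_Suc_remove[OF assms, of _ j x] Suc by (simp flip: sum_constant cong: sum.cong)
  also have "\<dots> = (\<Sum>a\<in>A. esym k x (A - {a})) + real k * esym k x A"
    using sum_mult_esym_remove[OF assms, where x = x and k = j] Suc by (simp add: sum.distrib)
  finally show ?thesis by (simp add: algebra_simps)
qed

section \<open>Chebyshev's and Maclaurin's inequalities\<close>

lemma esym_remove_antimono:
  assumes "finite A" "\<And>i. i \<in> A \<Longrightarrow> 0 \<le> x i" "a \<in> A" "b \<in> A"
  shows "(x a - x b) * (esym k x (A - {a}) - esym k x (A - {b})) \<le> 0"
proof (cases "a = b \<or> k = 0")
  case True
  then show ?thesis using assms(1) by (auto simp: esym_0)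
next
  case False
  then obtain j where k: "k = Suc j" and ab: "a \<noteq> b" using not0_implies_Suc by blast
  let ?C = "A - {a, b}"
  have "A - {a} - {b} = ?C" "A - {b} - {a} = ?C" by auto
  \<comment> \<open>The \<open>k\<close>-subsets avoiding both \<open>a\<close> and \<open>b\<close>
    cancel; each remaining one contains exactly one of the two. So removing the larger value never
    leaves the larger sum, which is the opposite ordering that Chebyshev's inequality asks
    for.\<close>
  then have "esym k x (A - {a}) - esym k x (A - {b}) = (x b - x a) * esym j x ?C"
    using esym_Suc_remove[of "A - {a}" b j x] esym_Suc_remove[of "A - {b}" a j x] assms ab k
    by (simp add: algebra_simps)
  then have "(x a - x b) * (esym k x (A - {a}) - esym k x (A - {b}))
      = - ((x a - x b)\<^sup>2 * esym j x ?C)"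
    by (simp only:) (simp add: power2_eq_square algebra_simps)
  moreover have "0 \<le> esym j x ?C" using assms by (intro esym_nonneg) auto
  ultimately show ?thesis by simp
qed

text \<open>Sum the hypothesis over all ordered pairs from \<open>A\<close> and expand.\<close>

lemma chebyshev_sum_le:
  fixes f g :: "'a \<Rightarrow> real"
  assumes "\<And>i j. i \<in> A \<Longrightarrow> j \<in> A \<Longrightarrow> (f i - f j) * (g i - g j) \<le> 0"
  shows "real (card A) * (\<Sum>i\<in>A. f i * g i) \<le> sum f A * sum g A"
proof -
  have "(\<Sum>i\<in>A. \<Sum>j\<in>A. (f i - f j) * (g i - g j)) \<le> 0"
    using assms by (intro sum_nonpos) auto
  moreover have "(\<Sum>i\<in>A. \<Sum>j\<in>A. (f i - f j) * (g i - g j))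
      = 2 * (real (card A) * (\<Sum>i\<in>A. f i * g i)) - 2 * (sum f A * sum g A)"
  proof -
    have 1: "(\<Sum>i\<in>A. \<Sum>j\<in>A. f i * g j) = sum f A * sum g A"
      by (simp add: sum_product)
    have 2: "(\<Sum>i\<in>A. \<Sum>j\<in>A. f j * g i) = sum f A * sum g A"
      using 1 sum.swap[of "\<lambda>i j. f j * g i" A A] by simp
    have "(\<Sum>i\<in>A. \<Sum>j\<in>A. (f i - f j) * (g i - g j))
        = (\<Sum>i\<in>A. \<Sum>j\<in>A. (f i * g i + f j * g j) - (f i * g j + f j * g i))"
      by (intro sum.cong refl) (simp add: algebra_simps)
    also have "\<dots> = 2 * (real (card A) * (\<Sum>i\<in>A. f i * g i)) - 2 * (sum f A * sum g A)"
      unfolding sum_subtractf sum.distrib 1 2 by (simp flip: sum_distrib_left)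
    finally show ?thesis .
  qed
  ultimately show ?thesis by simp
qed

text \<open>Induction on \<open>k\<close>. With \<open>m\<close> the mean of \<open>x\<close> and
  \<open>n = card A\<close>, Chebyshev's inequality gives
  \<open>(k + 1) e_(k+1) \<le> m (n - k) e_k\<close>, and the bounds on the right satisfy the same
  recursion with equality.\<close>

lemma maclaurin_esym_le:
  assumes "finite A" "\<And>i. i \<in> A \<Longrightarrow> 0 \<le> x i"
  shows "esym k x A \<le> real (card A choose k) * (sum x A / real (card A)) ^ k"
proof (cases "A = {}")
  case True
  then show ?thesis by (cases k) (auto simp: esym_0 esym_Suc_empty)
next
  case False
  then have n: "0 < card A" using assms(1) by (simp add: card_gt_0_iff)
  define m where "m = sum x A / real (card A)"
  have m: "0 \<le> m" unfolding m_def using assms by (intro divide_nonneg_nonneg sum_nonneg) auto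
  have "esym k x A \<le> real (card A choose k) * m ^ k"
  proof (induction k)
    case 0
    then show ?case using assms by (simp add: esym_0)
  next
    case (Suc k)
    have "real (card A) * (real (Suc k) * esym (Suc k) x A)
        \<le> sum x A * ((real (card A) - real k) * esym k x A)"
      using chebyshev_sum_le[of A x "\<lambda>a. esym k x (A - {a})", OF esym_remove_antimono[OF assms]]
        sum_mult_esym_remove[OF assms(1), of x k] sum_esym_remove[OF assms(1), of k x] by simp
    then have step: "real (Suc k) * esym (Suc k) x A \<le> m * ((real (card A) - real k) * esym k x A)"
      using n by (simp add: m_def field_simps)
    show ?case
    \<comment> \<open>The induction hypothesis can be multiplied by \<open>card A - k\<close> only
      when this is nonnegative; beyond that there is no \<open>Suc k\<close>-subset.\<close>
    proof (cases "k \<le> card A")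
      case True
      have "real (Suc k) * esym (Suc k) x A
          \<le> m * ((real (card A) - real k) * (real (card A choose k) * m ^ k))"
        using m True by (intro order_trans[OF step] mult_left_mono Suc.IH) auto
      also have "(real (card A) - real k) * real (card A choose k)
          = real (Suc k) * real (card A choose Suc k)"
      proof -
        have "(card A - k) * (card A choose k) = Suc k * (card A choose Suc k)"
          by (simp only: binomial_absorb_comp binomial_absorption)
        then have "real (card A - k) * real (card A choose k)
            = real (Suc k) * real (card A choose Suc k)"
          by (simp only: flip: of_nat_mult)
        then show ?thesis using True by (simp only: of_nat_diff)
      qed
      then have "m * ((real (card A) - real k) * (real (card A choose k) * m ^ k))
          = real (Suc k) * (real (card A choose Suc k) * m ^ Suc k)"
        by (simp add: algebra_simps)
      finally show ?thesis by (rule mult_left_le_imp_le) simp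
    next
      case False
      have "{S. S \<subseteq> A \<and> card S = Suc k} = {}"
      proof (intro equals0I)
        fix S assume "S \<in> {S. S \<subseteq> A \<and> card S = Suc k}"
        then show False using card_mono[OF assms(1), of S] False by simp
      qed
      then have "esym (Suc k) x A = 0" unfolding esym_def by (metis sum.empty)
      then show ?thesis using m by simp
    qed
  qed
  then show ?thesis by (simp add: m_def)
qed

lemma binomial_le_power_div_fact: "real (n choose k) \<le> real n ^ k / fact k"
proof -
  have "real (fact k * (n choose k)) \<le> real (n ^ k)"
    using binomial_fact_pow[of n k] by (simp only: of_nat_le_iff) (simp add: mult.commute)
  then show ?thesis by (simp add: field_simps)
qed

text \<open>Maclaurin's bound freed of \<open>card A\<close>, for the vertices without a singleton
  edge, whose number is arbitrary.\<close>

lemma esym_le_power_div_fact: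
  assumes "finite A" "\<And>i. i \<in> A \<Longrightarrow> 0 \<le> x i"
  shows "esym k x A \<le> sum x A ^ k / fact k"
proof (cases "A = {}")
  case True
  then show ?thesis by (cases k) (auto simp: esym_0 esym_Suc_empty)
next
  case False
  then have n: "0 < card A" using assms(1) by (simp add: card_gt_0_iff)
  have "esym k x A \<le> real (card A choose k) * (sum x A / real (card A)) ^ k"
    by (rule maclaurin_esym_le[OF assms])
  also have "\<dots> \<le> real (card A) ^ k / fact k * (sum x A / real (card A)) ^ k"
    using assms by (intro mult_right_mono binomial_le_power_div_fact zero_le_power
        divide_nonneg_nonneg sum_nonneg) auto
  finally show ?thesis using n by (simp add: power_divide)
qed

text \<open>Compare the coefficients of \<open>z^r\<close> in the product of the
  \<open>1 + x i * z\<close> over \<open>A \<union> B\<close>. The induction on \<open>A\<close>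
  keeps \<open>r\<close> arbitrary because inserting \<open>a\<close> refers to \<open>r - 1\<close>
  as well.\<close>

lemma esym_Un_disjoint:
  assumes "finite A" "finite B" "A \<inter> B = {}"
  shows "esym r x (A \<union> B) = (\<Sum>k\<le>r. esym k x A * esym (r - k) x B)"
  using assms
proof (induction A arbitrary: r rule: finite_induct)
  case empty
  then show ?case
  proof (cases r)
    case (Suc p)
    then show ?thesis
      by (simp add: sum.atMost_Suc_shift esym_0 esym_Suc_empty del: sum.atMost_Suc)
  qed (simp add: esym_0)
next
  case (insert a A)
  show ?case
  proof (cases r)
    case 0
    then show ?thesis using insert by (simp add: esym_0)
  next
    case (Suc p)
    have "esym r x (insert a A \<union> B) = esym (Suc p) x (A \<union> B) + x a * esym p x (A \<union> B)"
      using insert Suc by (simp add: esym_Suc_insert)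
    \<comment> \<open>Splitting off the term \<open>k = 0\<close> aligns both convolutions on
      \<open>k \<le> p\<close>.\<close>
    also have "\<dots> = esym (Suc p) x B + (\<Sum>k\<le>p. esym (Suc k) x A * esym (p - k) x B)
        + x a * (\<Sum>k\<le>p. esym k x A * esym (p - k) x B)"
      using insert by (simp add: sum.atMost_Suc_shift esym_0 del: sum.atMost_Suc)
    also have "\<dots> = esym (Suc p) x B
        + (\<Sum>k\<le>p. esym (Suc k) x (insert a A) * esym (p - k) x B)"
      using insert by (simp add: esym_Suc_insert algebra_simps sum.distrib sum_distrib_left)
    also have "\<dots> = (\<Sum>k\<le>r. esym k x (insert a A) * esym (r - k) x B)"
      using insert Suc by (simp add: sum.atMost_Suc_shift esym_0 del: sum.atMost_Suc)
    finally show ?thesis .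
  qed
qed

section \<open>The one-variable majorant\<close>

text \<open>
  The supremum of the \<open>r\<close>-th elementary symmetric sum when \<open>t\<close> variables share the weight \<open>s\<close>
  and arbitrarily many further ones share \<open>1 - s\<close>.
\<close>

definition majorant :: "nat \<Rightarrow> nat \<Rightarrow> real \<Rightarrow> real" where
  "majorant t r s = (\<Sum>k\<le>r. real (t choose k) * (s / real t) ^ k * ((1 - s) ^ (r - k) / fact (r - k)))"

lemma esym_le_majorant:
  assumes "finite A" "finite B" "A \<inter> B = {}" "\<And>i. i \<in> A \<union> B \<Longrightarrow> 0 \<le> x i"
    and "sum x (A \<union> B) = 1"
  shows "esym r x (A \<union> B) \<le> majorant (card A) r (sum x A)"
proof -
  have B: "sum x B = 1 - sum x A" using assms by (simp add: sum.union_disjoint)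
  have "esym r x (A \<union> B) = (\<Sum>k\<le>r. esym k x A * esym (r - k) x B)"
    using assms by (intro esym_Un_disjoint) auto
  also have "\<dots> \<le> (\<Sum>k\<le>r. real (card A choose k) * (sum x A / real (card A)) ^ k
      * (sum x B ^ (r - k) / fact (r - k)))"
    using assms
    by (intro sum_mono mult_mono maclaurin_esym_le esym_le_power_div_fact esym_nonneg
        mult_nonneg_nonneg zero_le_power divide_nonneg_nonneg sum_nonneg) auto
  finally show ?thesis by (simp add: majorant_def B)
qed

text \<open>Only \<open>k = r\<close> survives, because \<open>0 ^ (r - k)\<close> vanishes for
  \<open>k < r\<close> and \<open>0 ^ 0 = 1\<close>.\<close>

lemma majorant_1: "majorant t r 1 = real (t choose r) / real t ^ r"
proof (cases r)
  case (Suc p)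
  have "(\<Sum>k\<le>p. real (t choose k) * (1 / real t) ^ k * ((1 - 1) ^ (Suc p - k) / fact (Suc p - k))) = 0"
    by (intro sum.neutral) (auto simp: Suc_diff_le)
  then show ?thesis using Suc by (simp add: majorant_def power_divide)
qed (simp add: majorant_def)

section \<open>The derivative and the threshold on \<open>t\<close>\<close>

lemma convolution_le_power_div_fact:
  fixes t :: nat and s :: real
  assumes "0 < t" "0 \<le> s" "s \<le> 1"
  shows "(\<Sum>k\<le>q. real ((t - 1) choose k) * (s / real t) ^ k * ((1 - s) ^ (q - k) / fact (q - k)))
      \<le> (1 - s / real t) ^ q / fact q"
proof -
  let ?c = "real (t - 1) * (s / real t)"
  \<comment> \<open>Powers in place of binomial coefficients turn the sum into the expansion of
    \<open>((t - 1) s / t + 1 - s) ^ q\<close>, divided by \<open>fact q\<close>.\<close>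
  have "(\<Sum>k\<le>q. real ((t - 1) choose k) * (s / real t) ^ k * ((1 - s) ^ (q - k) / fact (q - k)))
      \<le> (\<Sum>k\<le>q. real (t - 1) ^ k / fact k * (s / real t) ^ k * ((1 - s) ^ (q - k) / fact (q - k)))"
    using assms by (intro sum_mono mult_right_mono binomial_le_power_div_fact) auto
  also have "\<dots> = (\<Sum>k\<le>q. real (q choose k) * ?c ^ k * (1 - s) ^ (q - k)) / fact q"
    unfolding sum_divide_distrib
    by (intro sum.cong refl) (simp add: binomial_fact power_mult_distrib power_divide mult_ac)
  also have "\<dots> = (?c + (1 - s)) ^ q / fact q"
    by (simp add: binomial_ring)
  also have "?c + (1 - s) = 1 - s / real t"
    using assms by (simp add: of_nat_diff field_simps)
  finally show ?thesis .
qed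

text \<open>\<open>majorant t r s\<close> is the coefficient of \<open>z^r\<close> in
  \<open>(1 + s z / t)^t exp((1 - s) z)\<close>. The logarithmic derivative of this series in
  \<open>s\<close> is \<open>z / (1 + s z / t) - z = - (s / t) z^2 / (1 + s z / t)\<close>, which
  lowers \<open>t\<close> by one and the index by two.\<close>

lemma majorant_has_derivative:
  assumes "0 < t"
  shows "(majorant t (Suc (Suc q)) has_real_derivative
      - (s / real t) * (\<Sum>k\<le>q. real ((t - 1) choose k) * (s / real t) ^ k
          * ((1 - s) ^ (q - k) / fact (q - k)))) (at s)"
proof -
  \<comment> \<open>Coefficients of \<open>(1 + s z / t)^t\<close>, of
    \<open>(1 + s z / t)^(t - 1)\<close> and of \<open>exp((1 - s) z)\<close>.\<close>
  define A where "A k s = real (t choose k) * (s / real t) ^ k" for k and s :: real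
  define D where "D k s = real ((t - 1) choose k) * (s / real t) ^ k" for k and s :: real
  define B where "B k s = (1 - s) ^ k / fact k" for k and s :: real
  obtain m where t: "t = Suc m" using assms gr0_conv_Suc by auto
  have A_0: "A 0 s = D 0 s" for s by (simp add: A_def D_def)
  have A_Suc: "A (Suc k) s = D (Suc k) s + s / real t * D k s" for k s
    by (simp add: A_def D_def t algebra_simps add_divide_distrib)
  have dA_0: "(A 0 has_real_derivative 0) (at s)" by (simp add: A_def[abs_def])
  have dA: "(A (Suc k) has_real_derivative D k s) (at s)" for k
  proof -
    have "(A (Suc k) has_real_derivative
        real (t choose Suc k) * (real (Suc k) * (s / real t) ^ k * (1 / real t))) (at s)"
      unfolding A_def[abs_def]
      by (rule derivative_eq_intros refl | use assms in simp; fail)+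
    also have "real (t choose Suc k) * (real (Suc k) * (s / real t) ^ k * (1 / real t))
        = (real (Suc k) * real (t choose Suc k)) / real t * (s / real t) ^ k"
      by simp
    also have "real (Suc k) * real (t choose Suc k) = real t * real ((t - 1) choose k)"
      unfolding t by (metis Suc_times_binomial diff_Suc_1 of_nat_mult)
    finally show ?thesis using assms by (simp add: D_def)
  qed
  have dB_0: "(B 0 has_real_derivative 0) (at s)" by (simp add: B_def[abs_def])
  have dB: "(B (Suc k) has_real_derivative - B k s) (at s)" for k
  proof -
    have "(B (Suc k) has_real_derivative
        real (Suc k) * (- 1 * (1 - s) ^ k) / fact (Suc k)) (at s)"
      unfolding B_def[abs_def] by (rule derivative_eq_intros refl | simp; fail)+
    also have "real (Suc k) * (- 1 * (1 - s) ^ k) / fact (Suc k) = - B k s"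
      by (simp add: B_def del: of_nat_Suc)
    finally show ?thesis .
  qed
  define p where "p = Suc q"
  \<comment> \<open>Differentiation lowers the index by one; the \<open>case\<close> gives
    derivative 0 to the constants \<open>A 0\<close> and \<open>B 0\<close>.\<close>
  let ?D = "\<lambda>k. (case k of 0 \<Rightarrow> 0 | Suc j \<Rightarrow> D j s) * B (Suc p - k) s
      + (case Suc p - k of 0 \<Rightarrow> 0 | Suc j \<Rightarrow> - B j s) * A k s"
  have "((\<lambda>s. \<Sum>k\<le>Suc p. A k s * B (Suc p - k) s) has_real_derivative (\<Sum>k\<le>Suc p. ?D k)) (at s)"
  proof (rule DERIV_sum)
    fix k
    have "(A k has_real_derivative (case k of 0 \<Rightarrow> 0 | Suc j \<Rightarrow> D j s)) (at s)"
      using dA_0 dA by (auto split: nat.split)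
    moreover have "(B (Suc p - k) has_real_derivative
        (case Suc p - k of 0 \<Rightarrow> 0 | Suc j \<Rightarrow> - B j s)) (at s)"
      using dB_0 dB by (auto split: nat.split)
    ultimately show "((\<lambda>s. A k s * B (Suc p - k) s) has_real_derivative ?D k) (at s)"
      by (rule DERIV_mult)
  qed
  also have "(\<Sum>k\<le>Suc p. ?D k) = (\<Sum>k\<le>p. D k s * B (p - k) s) - (\<Sum>k\<le>p. A k s * B (p - k) s)"
  proof -
    have "(\<Sum>k\<le>Suc p. (case k of 0 \<Rightarrow> 0 | Suc j \<Rightarrow> D j s) * B (Suc p - k) s)
        = (\<Sum>k\<le>p. D k s * B (p - k) s)"
      by (simp add: sum.atMost_Suc_shift del: sum.atMost_Suc)
    moreover have "(\<Sum>k\<le>Suc p. (case Suc p - k of 0 \<Rightarrow> 0 | Suc j \<Rightarrow> - B j s) * A k s)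
        = - (\<Sum>k\<le>p. A k s * B (p - k) s)"
      by (simp add: Suc_diff_le sum_negf mult.commute)
    ultimately show ?thesis by (simp only: sum.distrib)
  qed
  \<comment> \<open>The terms for \<open>k = 0\<close> cancel by \<open>A_0\<close>; in the others
    Pascal's rule \<open>A_Suc\<close> leaves \<open>- (s / t)\<close> times
    \<open>D (k - 1)\<close>.\<close>
  also have "\<dots> = - (s / real t) * (\<Sum>k\<le>q. D k s * B (q - k) s)"
    by (simp add: p_def sum.atMost_Suc_shift A_0 A_Suc algebra_simps sum.distrib sum_distrib_left
        sum_negf del: sum.atMost_Suc)
  finally show ?thesis
    by (simp add: majorant_def[abs_def] A_def D_def B_def p_def)
qed

text \<open>The last hypothesis is a rearrangement of
  \<open>\<alpha> (1 / t) (1 - f / \<alpha>)^q \<le> f\<close>. The exponent is an integer since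
  \<open>q - 1\<close> is -1 for \<open>q = 0\<close>.\<close>

lemma threshold_bound:
  fixes \<alpha> f u :: real
  assumes "0 < \<alpha>" "0 < f" "0 < t" "0 \<le> u" "u \<le> 1 / real t"
    and "(\<alpha> - f) ^ q / (f * \<alpha> powi (int q - 1)) \<le> real t"
  shows "\<alpha> * u * (1 - u) ^ q \<le> f"
proof -
  have "1 / real t \<le> 1" using assms(3) by simp
  then have u1: "u \<le> 1" using assms(5) by linarith
  show ?thesis
  proof (cases "\<alpha> * u \<le> f")
    case True
    have "\<alpha> * u * (1 - u) ^ q \<le> \<alpha> * u * 1"
      using assms u1 by (intro mult_left_mono power_le_one) auto
    then show ?thesis using True by linarith
  next
    case False
    \<comment> \<open>Here \<open>f < \<alpha> * u \<le> \<alpha>\<close>, so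
      \<open>\<alpha> - f\<close> is positive.\<close>
    then have "1 - u \<le> (\<alpha> - f) / \<alpha>" using assms by (simp add: field_simps)
    then have "(1 - u) ^ q \<le> ((\<alpha> - f) / \<alpha>) ^ q" using u1 by (intro power_mono) auto
    moreover have "\<alpha> * u \<le> \<alpha> * (1 / real t)" using assms by (intro mult_left_mono) auto
    ultimately have "\<alpha> * u * (1 - u) ^ q \<le> \<alpha> * (1 / real t) * ((\<alpha> - f) / \<alpha>) ^ q"
      using assms u1 by (intro mult_mono) auto
    also have "\<dots> = f / real t * ((\<alpha> - f) ^ q / (f * \<alpha> powi (int q - 1)))"
      using assms by (simp add: power_int_diff power_divide)
    also have "\<dots> \<le> f / real t * real t" using assms by (intro mult_left_mono) auto
    finally show ?thesis using assms(3) by simp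
  qed
qed

lemma majorant_le_at_1:
  assumes "0 < \<alpha>" "0 < t" "0 \<le> s" "s \<le> 1"
    and "(\<alpha> - fact q) ^ q / (fact q * \<alpha> powi (int q - 1)) \<le> real t"
  shows "s + \<alpha> * majorant t (Suc (Suc q)) s \<le> 1 + \<alpha> * majorant t (Suc (Suc q)) 1"
proof (rule DERIV_nonneg_imp_nondecreasing[OF assms(4),
      where f = "\<lambda>s. s + \<alpha> * majorant t (Suc (Suc q)) s"])
  fix v assume v: "s \<le> v" "v \<le> 1"
  let ?P = "\<Sum>k\<le>q. real ((t - 1) choose k) * (v / real t) ^ k * ((1 - v) ^ (q - k) / fact (q - k))"
  let ?u = "v / real t"
  have "((\<lambda>s. s + \<alpha> * majorant t (Suc (Suc q)) s) has_real_derivative 1 + \<alpha> * (- ?u * ?P)) (at v)"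
    using majorant_has_derivative[OF assms(2), of q v] by (auto intro!: derivative_eq_intros)
  moreover have "\<alpha> * ?u * ?P \<le> \<alpha> * ?u * ((1 - ?u) ^ q / fact q)"
    using assms v by (intro mult_left_mono convolution_le_power_div_fact) auto
  moreover have "\<alpha> * ?u * (1 - ?u) ^ q \<le> fact q"
    using assms v by (intro threshold_bound[where t = t]) (auto intro: divide_right_mono)
  then have "\<alpha> * ?u * ((1 - ?u) ^ q / fact q) \<le> 1"
    by (simp only: times_divide_eq_right) (simp only: divide_le_eq_1_pos fact_gt_zero)
  ultimately show "\<exists>y. ((\<lambda>s. s + \<alpha> * majorant t (Suc (Suc q)) s) has_real_derivative y) (at v) \<and> 0 \<le> y"
    by (intro exI[of _ "1 + \<alpha> * (- ?u * ?P)"]) auto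
qed

section \<open>The Lagrangian\<close>

lemma lagrange_poly_le:
  assumes "0 < \<alpha>" "hypergraph n E" "x \<in> simplex n" "0 < t"
    and card: "card {i. {i} \<in> E} = t"
    and "(\<alpha> - fact q) ^ q / (fact q * \<alpha> powi (int q - 1)) \<le> real t"
  shows "lagrange_poly \<alpha> (Suc (Suc q)) n E x
      \<le> 1 + \<alpha> * (real (t choose Suc (Suc q)) / real t ^ Suc (Suc q))"
proof -
  let ?U = "{i. {i} \<in> E}" and ?r = "Suc (Suc q)"
  have U: "?U \<subseteq> {1..n}" using assms(2) by (auto simp: hypergraph_def)
  then have Un: "?U \<union> ({1..n} - ?U) = {1..n}" and fU: "finite ?U" by (auto intro: finite_subset)
  have x: "\<And>i. i \<in> {1..n} \<Longrightarrow> 0 \<le> x i" "sum x {1..n} = 1"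
    using assms(3) by (auto simp: simplex_def)
  have "sum x ?U \<le> sum x {1..n}" using U x by (intro sum_mono2) auto
  then have s: "0 \<le> sum x ?U" "sum x ?U \<le> 1" using x U by (auto intro!: sum_nonneg)
  \<comment> \<open>Adjoining the missing \<open>r\<close>-edges only raises the sum, as
    \<open>x\<close> is nonnegative.\<close>
  have "(\<Sum>e | e \<in> E \<and> card e = ?r. \<Prod>i\<in>e. x i) \<le> esym ?r x {1..n}"
    unfolding esym_def using assms(2) x
    by (intro sum_mono2) (auto simp: hypergraph_def intro!: prod_nonneg)
  also have "\<dots> \<le> majorant t ?r (sum x ?U)"
    using esym_le_majorant[of ?U "{1..n} - ?U" x ?r] Un fU x card by (simp only: Un) auto
  finally have "\<alpha> * (\<Sum>e | e \<in> E \<and> card e = ?r. \<Prod>i\<in>e. x i) \<le> \<alpha> * majorant t ?r (sum x ?U)"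
    using assms(1) by simp
  moreover have "{i. i \<in> {1..n} \<and> {i} \<in> E} = ?U" using U by auto
  ultimately have "lagrange_poly \<alpha> ?r n E x \<le> sum x ?U + \<alpha> * majorant t ?r (sum x ?U)"
    by (simp add: lagrange_poly_def)
  also have "\<dots> \<le> 1 + \<alpha> * majorant t ?r 1"
    using assms s by (intro majorant_le_at_1) auto
  finally show ?thesis by (simp only: majorant_1)
qed

lemma lagrange_poly_char_vec:
  assumes "hypergraph n E" "0 < r" "0 < card {i. {i} \<in> E}"
    and "\<And>e. e \<subseteq> {i. {i} \<in> E} \<Longrightarrow> card e = r \<Longrightarrow> e \<in> E"
  shows "lagrange_poly \<alpha> r n E (char_vec {i. {i} \<in> E})
      = 1 + \<alpha> * (real (card {i. {i} \<in> E} choose r) / real (card {i. {i} \<in> E}) ^ r)"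
proof -
  let ?U = "{i. {i} \<in> E}"
  let ?c = "char_vec ?U"
  have U: "{i. i \<in> {1..n} \<and> {i} \<in> E} = ?U" using assms(1) by (auto simp: hypergraph_def)
  have fU: "finite ?U" using assms(3) card_gt_0_iff by blast
  have fE: "finite E" using assms(1) by (intro finite_subset[of E "Pow {1..n}"]) (auto simp: hypergraph_def)
  have "sum ?c ?U = (\<Sum>i\<in>?U. 1 / real (card ?U))"
    by (intro sum.cong) (auto simp: char_vec_def)
  then have 1: "sum ?c ?U = 1" using assms(3) by simp
  \<comment> \<open>An \<open>r\<close>-edge that leaves \<open>?U\<close> contains a vertex of
    weight 0, and every \<open>r\<close>-subset of \<open>?U\<close> is an edge.\<close>
  have "(\<Sum>e | e \<in> E \<and> card e = r. \<Prod>i\<in>e. ?c i) = (\<Sum>e | e \<subseteq> ?U \<and> card e = r. \<Prod>i\<in>e. ?c i)"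
  proof (rule sum.mono_neutral_right)
    show "finite {e \<in> E. card e = r}" using fE by simp
    show "{e. e \<subseteq> ?U \<and> card e = r} \<subseteq> {e \<in> E. card e = r}" using assms(4) by blast
    show "\<forall>e\<in>{e \<in> E. card e = r} - {e. e \<subseteq> ?U \<and> card e = r}. (\<Prod>i\<in>e. ?c i) = 0"
    proof
      fix e assume e: "e \<in> {e \<in> E. card e = r} - {e. e \<subseteq> ?U \<and> card e = r}"
      then obtain i where "i \<in> e" "i \<notin> ?U" by auto
      moreover have "finite e" using e assms(2) by (intro card_ge_0_finite) auto
      ultimately show "(\<Prod>i\<in>e. ?c i) = 0" by (intro prod_zero) (auto simp: char_vec_def)
    qed
  qed
  also have "\<dots> = (\<Sum>e | e \<subseteq> ?U \<and> card e = r. (1 / real (card ?U)) ^ r)"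
  proof (intro sum.cong refl)
    fix e assume e: "e \<in> {e. e \<subseteq> ?U \<and> card e = r}"
    then have "(\<Prod>i\<in>e. ?c i) = (\<Prod>i\<in>e. 1 / real (card ?U))"
      by (intro prod.cong) (auto simp: char_vec_def)
    then show "(\<Prod>i\<in>e. ?c i) = (1 / real (card ?U)) ^ r" using e by simp
  qed
  also have "\<dots> = real (card ?U choose r) / real (card ?U) ^ r"
    using n_subsets[OF fU, of r] by (simp add: power_divide)
  finally show ?thesis using 1 U by (simp add: lagrange_poly_def)
qed

lemma char_vec_in_simplex:
  assumes "U \<subseteq> {1..n}" "0 < card U"
  shows "char_vec U \<in> simplex n"
proof -
  have "sum (char_vec U) {1..n} = sum (char_vec U) U"
    using assms by (intro sum.mono_neutral_right) (auto simp: char_vec_def)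
  also have "\<dots> = (\<Sum>i\<in>U. 1 / real (card U))" by (intro sum.cong) (auto simp: char_vec_def)
  finally show ?thesis using assms by (auto simp: simplex_def char_vec_def)
qed

text \<open>An exhibited maximizer is the witness that determines \<open>GREATEST\<close>.\<close>

lemma lagrangian_eq:
  assumes "is_arg_max (lagrange_poly \<alpha> r n E) (\<lambda>x. x \<in> simplex n) c"
  shows "lagrangian \<alpha> r n E = lagrange_poly \<alpha> r n E c"
  unfolding lagrangian_def using assms
  by (intro Greatest_equality) (auto simp: is_arg_max_def not_less)

text \<open>The value at this vector equals the upper bound of \<open>lagrange_poly_le\<close>. The
  hypotheses are phrased so as to fit both \<open>H\<close> and \<open>K_t\<close>.\<close>

lemma char_vec_is_arg_max:
  assumes "0 < \<alpha>" "hypergraph n E" "0 < t" "card {i. {i} \<in> E} = t"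
    and "(\<alpha> - fact q) ^ q / (fact q * \<alpha> powi (int q - 1)) \<le> real t"
    and "\<And>e. e \<subseteq> {i. {i} \<in> E} \<Longrightarrow> card e = Suc (Suc q) \<Longrightarrow> e \<in> E"
  shows "is_arg_max (lagrange_poly \<alpha> (Suc (Suc q)) n E) (\<lambda>x. x \<in> simplex n) (char_vec {i. {i} \<in> E})"
proof -
  have "{i. {i} \<in> E} \<subseteq> {1..n}" using assms(2) by (auto simp: hypergraph_def)
  then have "char_vec {i. {i} \<in> E} \<in> simplex n"
    using assms(3,4) by (intro char_vec_in_simplex) auto
  moreover have "lagrange_poly \<alpha> (Suc (Suc q)) n E x
      \<le> lagrange_poly \<alpha> (Suc (Suc q)) n E (char_vec {i. {i} \<in> E})" if "x \<in> simplex n" for x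
  proof -
    have "lagrange_poly \<alpha> (Suc (Suc q)) n E (char_vec {i. {i} \<in> E})
        = 1 + \<alpha> * (real (t choose Suc (Suc q)) / real t ^ Suc (Suc q))"
      using lagrange_poly_char_vec[OF assms(2) _ _ assms(6), where \<alpha> = \<alpha>] assms(3,4)
      by (simp only: zero_less_Suc)
    then show ?thesis using lagrange_poly_le[OF assms(1,2) that assms(3,4,5)] by (simp only:)
  qed
  ultimately show ?thesis by (auto simp: is_arg_max_def not_less)
qed

section \<open>Maximum complete subgraphs and the value of the Lagrangian\<close>

lemma max_complete_order_attained:
  assumes "hypergraph n E" "0 \<notin> T"
  obtains W where "complete_subgraph T n E W" "card W = max_complete_order T n E"
    "\<And>W'. complete_subgraph T n E W' \<Longrightarrow> card W' \<le> card W"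
proof -
  let ?C = "{card W | W. complete_subgraph T n E W}"
  have "{W. complete_subgraph T n E W} \<subseteq> Pow {1..n}" by (auto simp: complete_subgraph_def)
  then have "finite {W. complete_subgraph T n E W}" using finite_subset by blast
  moreover have "?C = card ` {W. complete_subgraph T n E W}" by auto
  ultimately have f: "finite ?C" by simp
  \<comment> \<open>\<open>Max\<close> needs a nonempty set; the only subset of the empty set has
    size 0, which is not in \<open>T\<close>.\<close>
  have "complete_subgraph T n E {}" using assms(2) by (auto simp: complete_subgraph_def)
  then have "Max ?C \<in> ?C" by (intro Max_in[OF f]) auto
  then obtain W where "complete_subgraph T n E W" "card W = Max ?C" by auto
  then show thesis using that[of W] Max_ge[OF f] by (auto simp: max_complete_order_def)
qed

lemma complete_subgraph_1_iff:
  assumes "hypergraph n E"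
  shows "complete_subgraph {1} n E W \<longleftrightarrow> W \<subseteq> {i. {i} \<in> E}"
  using assms by (auto simp: complete_subgraph_def hypergraph_def card_1_singleton_iff)

text \<open>The factor \<open>i = 0\<close> of the falling factorial cancels one factor
  \<open>real t\<close>. For \<open>t < r\<close> both sides are 0, the product through its factor
  \<open>i = t\<close>.\<close>

lemma binomial_div_power:
  assumes "0 < t" "0 < r"
  shows "real (t choose r) / real t ^ r
      = (\<Prod>i=1..r - 1. (real t - real i)) / (fact r * real t ^ (r - 1))"
proof -
  obtain p where r: "r = Suc p" using assms(2) gr0_conv_Suc by auto
  have "real (t choose r) = (\<Prod>i=0..<r. real t - real i) / fact r"
    by (simp add: binomial_gbinomial gbinomial_prod_rev)
  also have "(\<Prod>i=0..<r. real t - real i) = real t * (\<Prod>i=1..p. real t - real i)"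
    by (simp add: r atLeastLessThanSuc_atLeastAtMost prod.atLeast_Suc_atMost del: prod.op_ivl_Suc)
  finally show ?thesis using assms(1) by (simp add: r)
qed

theorem theorem7:
  fixes r n t :: nat and \<alpha> :: real and E :: "nat set set"
  assumes "r > 1"
    and "\<alpha> > 0"
    and "graph_of_type {1, r} n E"
    and "max_complete_order {1, r} n E = t"
    and "max_complete_order {1} n E = t"
    and "int t \<ge> \<lceil>(\<alpha> - fact (r - 2)) ^ (r - 2) / (fact (r - 2) * \<alpha> powi (int r - 3))\<rceil>"
  shows "lagrangian \<alpha> r n E = lagrangian \<alpha> r t (complete_edges t {1, r})
    \<and> lagrangian \<alpha> r t (complete_edges t {1, r}) =
        1 + \<alpha> * ((\<Prod>i=1..r - 1. (real t - real i)) / (fact r * real t ^ (r - 1)))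
    \<and> (\<forall>U. maximum_clique n E U \<longrightarrow>
          is_arg_max (lagrange_poly \<alpha> r n E) (\<lambda>x. x \<in> simplex n) (char_vec U))"
proof -
  obtain q where r: "r = Suc (Suc q)" using assms(1) by (metis One_nat_def less_imp_Suc_add add_Suc)
  have E: "hypergraph n E" "edge_types E = {1, r}" using assms(3) by (auto simp: graph_of_type_def)
  let ?U = "{i. {i} \<in> E}"
  have fU: "finite ?U"
    using E(1) by (intro finite_subset[of ?U "{1..n}"]) (auto simp: hypergraph_def)
  \<comment> \<open>The complete \<open>{1}\<close>-subgraphs are the subsets of \<open>?U\<close>,
    so the largest is \<open>?U\<close> itself.\<close>
  have cU: "card ?U = t"
  proof -
    obtain W where W: "complete_subgraph {1} n E W" "card W = t"
      "\<And>W'. complete_subgraph {1} n E W' \<Longrightarrow> card W' \<le> card W"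
      using max_complete_order_attained[OF E(1), of "{1}"] assms(5) by auto
    have "card ?U \<le> card W" by (rule W(3)) (simp only: complete_subgraph_1_iff[OF E(1)])
    moreover have "card W \<le> card ?U"
      using W(1) card_mono[OF fU] by (simp only: complete_subgraph_1_iff[OF E(1)])
    ultimately show ?thesis using W(2) by simp
  qed
  \<comment> \<open>An edge of size 1 exists because 1 is an edge type; hence \<open>t\<close> is
    positive.\<close>
  have "1 \<in> card ` E" using E(2) by (simp add: edge_types_def)
  then have "?U \<noteq> {}" by (metis (mono_tags) card_1_singletonE empty_iff imageE mem_Collect_eq)
  then have "0 < card ?U" using fU by (metis card_gt_0_iff)
  then have t: "0 < t" using cU by simp
  \<comment> \<open>A complete \<open>{1, r}\<close>-subgraph lies in \<open>?U\<close>, which has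
    only \<open>t\<close> elements; so the one of order \<open>t\<close> is unique.\<close>
  have max_eq: "W = ?U" if "complete_subgraph {1, r} n E W" "card W = t" for W
  proof -
    have "complete_subgraph {1} n E W" using that(1) by (auto simp: complete_subgraph_def)
    then show ?thesis
      using complete_subgraph_1_iff[OF E(1)] card_subset_eq[OF fU] cU that(2) by auto
  qed
  obtain W where W: "complete_subgraph {1, r} n E W" "card W = t"
    "\<And>W'. complete_subgraph {1, r} n E W' \<Longrightarrow> card W' \<le> card W"
    using max_complete_order_attained[OF E(1), of "{1, r}"] assms(1,4) by auto
  have Ue: "e \<in> E" if "e \<subseteq> ?U" "card e = r" for e
    using W(1) that unfolding complete_subgraph_def max_eq[OF W(1,2)] by blast
  \<comment> \<open>The ceiling drops out because \<open>t\<close> is an integer;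
    \<open>int r - 3\<close> becomes \<open>int q - 1\<close>.\<close>
  have thr: "(\<alpha> - fact q) ^ q / (fact q * \<alpha> powi (int q - 1)) \<le> real t"
  proof -
    have "int r - 3 = int q - 1" "r - 2 = q" using r by auto
    then show ?thesis using assms(6) by (simp add: ceiling_le_iff)
  qed
  let ?v = "1 + \<alpha> * (real (t choose r) / real t ^ r)"
  have argmax: "is_arg_max (lagrange_poly \<alpha> r n E) (\<lambda>x. x \<in> simplex n) (char_vec ?U)"
    unfolding r by (rule char_vec_is_arg_max[OF assms(2) E(1) t cU thr Ue[unfolded r]])
  have L: "lagrangian \<alpha> r n E = ?v"
    using lagrangian_eq[OF argmax] lagrange_poly_char_vec[OF E(1) _ _ Ue, where \<alpha> = \<alpha>] cU t assms(1)
    by simp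
  \<comment> \<open>\<open>K_t\<close> meets the same hypotheses with \<open>{1..t}\<close> in the
    role of \<open>?U\<close>, hence has the same value \<open>?v\<close>.\<close>
  let ?K = "complete_edges t {1, r}"
  have K: "hypergraph t ?K" by (auto simp: hypergraph_def complete_edges_def)
  have KU: "{i. {i} \<in> ?K} = {1..t}" by (auto simp: complete_edges_def)
  then have cK: "card {i. {i} \<in> ?K} = t" by simp
  have Ke: "e \<in> ?K" if "e \<subseteq> {i. {i} \<in> ?K}" "card e = r" for e
    using that unfolding KU by (auto simp: complete_edges_def)
  have "is_arg_max (lagrange_poly \<alpha> r t ?K) (\<lambda>x. x \<in> simplex t) (char_vec {i. {i} \<in> ?K})"
    unfolding r by (rule char_vec_is_arg_max[OF assms(2) K[unfolded r] t cK[unfolded r] thr Ke[unfolded r]])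
  then have LK: "lagrangian \<alpha> r t ?K = ?v"
    using lagrangian_eq[where E = ?K] lagrange_poly_char_vec[OF K _ _ Ke, where \<alpha> = \<alpha>] cK t assms(1) by simp
  \<comment> \<open>As \<open>edge_types E = {1, r}\<close>, cliques are the complete
    \<open>{1, r}\<close>-subgraphs; a maximum one has order \<open>t\<close> and is therefore
    \<open>?U\<close>.\<close>
  have "X = ?U" if "maximum_clique n E X" for X
  proof (rule max_eq)
    show X: "complete_subgraph {1, r} n E X"
      using that E(2) by (auto simp: maximum_clique_def is_arg_max_def clique_def)
    have "\<not> card X < card W"
      using that W(1) E(2) by (auto simp: maximum_clique_def is_arg_max_def clique_def)
    then show "card X = t" using W(2) W(3)[OF X] by simp
  qed
  then show ?thesis
    using L LK argmax binomial_div_power[OF t, of r] assms(1) by auto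
qed

end
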